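(* If $X$ is a mixing coded system, then $X$ has the strong property $P$.
   Context: Let $\mathcal A$ be a finite alphabet with at least two elements, and let $\mathcal A^{\mathbb Z}$ carry the product topology. A shift space is a closed shift-invariant subset $X\subset\mathcal A^{\mathbb Z}$; $\mathcal B(X)$ is the set of all finite words occurring in points of $X$, and $\mathcal B_n(X)$ the set of those of length $n$. A coded system is a shift space which is the closure in $\mathcal A^{\mathbb Z}$ of the set of label sequences of bi-infinite paths in some irreducible directed graph with at most countably many vertices and edges, whose edges are labeled by symbols of $\mathcal A$ (irreducible: every ordered pair of vertices is joined by a path). Equivalently, it is the closure of the set of all bi-infinite concatenations of words from some (possibly infinite) set of words over $\mathcal A$. A shift space $X$ is mixing if for all $u,v\in\mathcal B(X)$ there is $N>0$ such that for every $n>N$ there is $w\in\mathcal B_n(X)$ with $uwv\in\mathcal B(X)$. $X$ has the strong property $P$ if for any $k\ge2$ and any words $u_1,\dots,u_k\in\mathcal B(X)$ with $|u_1|=\dots=|u_k|$ there is $n\in\mathbb N$ such that for any $N\in\mathbb N$ and any function $\varphi\colon\{1,\dots,N\}\to\{1,\dots,k\}$ there are words $w_1,\dots,w_{N-1}\in\mathcal B_n(X)$ such that $u_{\varphi(1)}w_1u_{\varphi(2)}w_2\cdots u_{\varphi(N-1)}w_{N-1}u_{\varphi(N)}\in\mathcal B(X)$. *)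

theory Defs
  imports "HOL-Analysis.Analysis" "Graph_Theory.Digraph_Component"
begin

definition full_shift_topology :: "(int \<Rightarrow> 'a) topology" where
  "full_shift_topology = product_topology (\<lambda>_. discrete_topology UNIV) UNIV"

definition shift :: "(int \<Rightarrow> 'a) \<Rightarrow> (int \<Rightarrow> 'a)" where
  "shift x = (\<lambda>i. x (i + 1))"

(* The two-sided shift is a homeomorphism, so invariance is an equality of sets;
   the inclusion of the image in X alone would be weaker. The empty set is allowed. *)
definition shift_space :: "(int \<Rightarrow> 'a) set \<Rightarrow> bool" where
  "shift_space X \<longleftrightarrow> closedin full_shift_topology X \<and> shift ` X = X"

definition language :: "(int \<Rightarrow> 'a) set \<Rightarrow> 'a list set" where
  "language X = {map (\<lambda>j. x (i + int j)) [0..<n] | x i n. x \<in> X}"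

definition language_n :: "nat \<Rightarrow> (int \<Rightarrow> 'a) set \<Rightarrow> 'a list set" where
  "language_n n X = {w \<in> language X. length w = n}"

definition biinfinite_path :: "('v, 'e) pre_digraph \<Rightarrow> (int \<Rightarrow> 'e) \<Rightarrow> bool" where
  "biinfinite_path G p \<longleftrightarrow>
     (\<forall>i. p i \<in> arcs G \<and> head G (p i) = tail G (p (i + 1)))"

definition label_sequences :: "('v, 'e) pre_digraph \<Rightarrow> ('e \<Rightarrow> 'a) \<Rightarrow> (int \<Rightarrow> 'a) set" where
  "label_sequences G L = {L \<circ> p | p. biinfinite_path G p}"

(* A graph with at most countably many vertices and edges is, up to isomorphism, one
   whose vertices and edges are natural numbers. Loops and parallel edges are allowed. *)
definition coded_system :: "(int \<Rightarrow> 'a) set \<Rightarrow> bool" where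
  "coded_system X \<longleftrightarrow> shift_space X \<and>
     (\<exists>(G :: (nat, nat) pre_digraph) L. wf_digraph G \<and> strongly_connected G \<and>
        X = full_shift_topology closure_of label_sequences G L)"

definition mixing :: "(int \<Rightarrow> 'a) set \<Rightarrow> bool" where
  "mixing X \<longleftrightarrow> (\<forall>u \<in> language X. \<forall>v \<in> language X.
     \<exists>N>0. \<forall>n>N. \<exists>w \<in> language_n n X. u @ w @ v \<in> language X)"

(* The positive integers are meant wherever a natural number is quantified: for N so that
   the last word exists, and for the common gap length n so that it is at least 1. *)
definition strong_property_P :: "(int \<Rightarrow> 'a) set \<Rightarrow> bool" where
  "strong_property_P X \<longleftrightarrow>
     (\<forall>k\<ge>2. \<forall>u :: nat \<Rightarrow> 'a list.
        (\<forall>i\<in>{1..k}. u i \<in> language X) \<and>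
        (\<forall>i\<in>{1..k}. \<forall>j\<in>{1..k}. length (u i) = length (u j)) \<longrightarrow>
        (\<exists>n\<ge>1. \<forall>N\<ge>1. \<forall>\<phi> \<in> {1..N} \<rightarrow> {1..k}.
           \<exists>w. (\<forall>i\<in>{1..<N}. w i \<in> language_n n X) \<and>
               concat (map (\<lambda>i. u (\<phi> i) @ w i) [1..<N]) @ u (\<phi> N) \<in> language X))"

end

theory Submission
  imports Defs "HOL-Library.Sublist"
begin

text \<open>Fix a vertex \<open>v\<close> of the graph and a cycle at \<open>v\<close>, of length \<open>m\<close>. By mixing, a word \<open>u\<close> of the
  language occurs in a single word of the language at positions of every residue modulo \<open>m\<close>.
  Completing a path that carries this word to a closed walk at \<open>v\<close>, one finds a closed walk labelled
  \<open>a u b\<close> with \<open>m\<close> dividing the length of \<open>a\<close>; replacing \<open>b\<close> by \<open>b (a u b)\<^sup>m\<^sup>-\<^sup>1\<close> makes the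
  total length divisible by \<open>m\<close> as well. Padding with the cycle on both sides, finitely many words
  \<open>u\<close> of equal length can be given prefixes \<open>a\<close> of a common length and suffixes \<open>b\<close> of a common
  length, and the closed walks \<open>a u b\<close> concatenate freely. In particular, periods of the graph
  never have to be computed.\<close>

section \<open>Words of a set of sequences and of its closure\<close>

lemma language_sublist:
  assumes "W \<in> language X" "sublist w W"
  shows "w \<in> language X"
proof -
  obtain x i n where x: "x \<in> X" and W: "W = map (\<lambda>j. x (i + int j)) [0..<n]"
    using assms(1) by (auto simp: language_def)
  obtain ps ss where d: "W = ps @ w @ ss"
    using assms(2) by (auto simp: sublist_def)
  have len: "length ps + length w + length ss = n"
    using arg_cong[OF d, of length] W by simp
  have "w = map (\<lambda>j. x ((i + int (length ps)) + int j)) [0..<length w]"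
  proof (rule nth_equalityI)
    fix k assume k: "k < length w"
    have "w ! k = W ! (length ps + k)"
      using d k by (simp add: nth_append)
    also have "\<dots> = x (i + int (length ps + k))"
      using W len k by simp
    finally show "w ! k = map (\<lambda>j. x ((i + int (length ps)) + int j)) [0..<length w] ! k"
      using k by (simp add: add.assoc)
  qed simp
  then show ?thesis
    using x unfolding language_def by blast
qed

lemma openin_cylinder:
  assumes "finite I"
  shows "openin full_shift_topology {y. \<forall>i\<in>I. y i = x i}"
proof -
  have eq: "{y. \<forall>i\<in>I. y i = x i} = (\<Pi>\<^sub>E i\<in>UNIV. if i \<in> I then {x i} else UNIV)"
    by (auto simp: PiE_def Pi_def extensional_def split: if_splits)
  have "finite {i. (if i \<in> I then {x i} else UNIV) \<noteq> UNIV}"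
    by (rule finite_subset[OF _ assms]) auto
  then show ?thesis
    unfolding full_shift_topology_def eq openin_PiE_gen by simp
qed

text \<open>Agreement on a finite window is an open condition, so a word seen in a point of the
  closure is already seen in a point of \<open>S\<close>. Words can thus be read off from label
  sequences alone.\<close>

lemma language_closure_of:
  "language (full_shift_topology closure_of S) = language S"
proof
  show "language (full_shift_topology closure_of S) \<subseteq> language S"
  proof
    fix w assume "w \<in> language (full_shift_topology closure_of S)"
    then obtain x i n where x: "x \<in> full_shift_topology closure_of S"
      and w: "w = map (\<lambda>j. x (i + int j)) [0..<n]"
      by (auto simp: language_def)
    let ?C = "{y. \<forall>k\<in>(\<lambda>j. i + int j) ` {..<n}. y k = x k}"
    have "openin full_shift_topology ?C" and "x \<in> ?C"
      using openin_cylinder[of "(\<lambda>j. i + int j) ` {..<n}" x] by auto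
    then obtain y where y: "y \<in> S" "y \<in> ?C"
      using x by (meson in_closure_of)
    have "w = map (\<lambda>j. y (i + int j)) [0..<n]"
      using y(2) w by auto
    then show "w \<in> language S"
      using y(1) unfolding language_def by blast
  qed
  have "S \<subseteq> full_shift_topology closure_of S"
    by (rule closure_of_subset) (simp add: full_shift_topology_def)
  then show "language S \<subseteq> language (full_shift_topology closure_of S)"
    unfolding language_def by blast
qed

section \<open>Walks in the graph and the words they spell\<close>

context wf_digraph
begin

lemma biinfinite_path_awalk:
  assumes "biinfinite_path G p"
  shows "awalk (tail G (p i)) (map (\<lambda>j. p (i + int j)) [0..<n]) (tail G (p (i + int n)))"
proof (induction n)
  case 0
  then show ?case
    using assms by (simp add: awalk_Nil_iff biinfinite_path_def)
next
  case (Suc n)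
  have "awalk (tail G (p (i + int n))) [p (i + int n)] (tail G (p (i + int (Suc n))))"
    using assms arc_implies_awalk[of "p (i + int n)"]
    by (simp add: biinfinite_path_def add.assoc add.commute[of 1])
  then show ?case
    using awalk_appendI[OF Suc] by simp
qed

lemma awalk_head_tail_nth:
  assumes "awalk u es v" "Suc k < length es"
  shows "head G (es ! k) = tail G (es ! Suc k)"
  using assms
proof (induction es arbitrary: u k)
  case (Cons e es)
  then have aw: "awalk (head G e) es v"
    by (simp add: awalk_Cons_iff)
  show ?case
  proof (cases k)
    case 0
    with Cons.prems aw show ?thesis
      by (cases es) (auto simp: awalk_Cons_iff)
  next
    case (Suc k')
    with Cons.IH[OF aw, of k'] Cons.prems show ?thesis by simp
  qed
qed simp

text \<open>The walk is repeated periodically in both directions; the seam is consistent because the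
  walk ends where it began.\<close>

lemma closed_awalk_biinfinite_path:
  assumes "awalk v es v" "es \<noteq> []"
  shows "biinfinite_path G (\<lambda>i. es ! nat (i mod int (length es)))"
  unfolding biinfinite_path_def
proof
  fix i
  let ?l = "length es"
  define k where "k = nat (i mod int ?l)"
  have l: "0 < ?l" using assms(2) by simp
  have k: "k < ?l" and ik: "i mod int ?l = int k"
    using l by (auto simp: k_def nat_less_iff)
  have next_pos: "(i + 1) mod int ?l = int (Suc k) mod int ?l"
    using ik by (metis mod_add_left_eq of_nat_Suc add.commute)
  have "head G (es ! k) = tail G (es ! nat ((i + 1) mod int ?l))"
  proof (cases "Suc k < ?l")
    case True
    then show ?thesis
      using awalk_head_tail_nth[OF assms(1)] next_pos by (simp add: nat_add_distrib)
  next
    case False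
    \<comment> \<open>At the seam, position \<open>i + 1\<close> wraps around to index 0.\<close>
    then have s: "Suc k = ?l" using k by simp
    have "head G (last es) = v"
      using assms by (cases es rule: rev_cases) (auto simp: awalk_Cons_iff awalk_Nil_iff)
    moreover have "tail G (hd es) = v"
      using assms by (cases es) (auto simp: awalk_Cons_iff)
    moreover have "es ! k = last es"
      using s assms(2) by (simp add: last_conv_nth flip: s)
    moreover have "es ! nat ((i + 1) mod int ?l) = hd es"
      using s next_pos assms(2) by (simp add: hd_conv_nth)
    ultimately show ?thesis by simp
  qed
  moreover have "es ! k \<in> arcs G"
    using assms(1) k by (auto simp: awalk_def)
  ultimately show "es ! nat (i mod int ?l) \<in> arcs G \<and>
      head G (es ! nat (i mod int ?l)) = tail G (es ! nat ((i + 1) mod int ?l))"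
    by (simp add: k_def)
qed

lemma language_label_sequences_awalk:
  assumes "w \<in> language (label_sequences G L)"
  obtains u es v where "awalk u es v" "w = map L es"
proof -
  obtain p i n where "biinfinite_path G p" "w = map (\<lambda>j. (L \<circ> p) (i + int j)) [0..<n]"
    using assms by (auto simp: language_def label_sequences_def)
  then show ?thesis
    using that[OF biinfinite_path_awalk[of p i n]] by (simp add: o_def)
qed

lemma closed_awalk_language:
  assumes "awalk v es v" "es \<noteq> []"
  shows "map L es \<in> language (label_sequences G L)"
proof -
  let ?p = "\<lambda>i. es ! nat (i mod int (length es))"
  have "map L es = map (\<lambda>j. (L \<circ> ?p) (0 + int j)) [0..<length es]"
    by (rule nth_equalityI) (auto simp flip: of_nat_mod)
  moreover have "L \<circ> ?p \<in> label_sequences G L"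
    using closed_awalk_biinfinite_path[OF assms] unfolding label_sequences_def by blast
  ultimately show ?thesis
    unfolding language_def by blast
qed

end

text \<open>\<open>M\<close> consists of the labels of closed walks at one vertex \<open>v\<close>,
  and \<open>c\<close> labels a cycle there. Such walks can be concatenated, and strong connectivity
  completes any walk to one of them. The later argument uses nothing else of the graph.\<close>

lemma coded_system_word_monoid:
  assumes "coded_system X" "X \<noteq> {}"
  obtains M c where "M \<subseteq> language X" "[] \<in> M" "\<And>x y. x \<in> M \<Longrightarrow> y \<in> M \<Longrightarrow> x @ y \<in> M"
    "\<And>w. w \<in> language X \<Longrightarrow> \<exists>f g. f @ w @ g \<in> M" "c \<in> M" "c \<noteq> []"
proof -
  obtain G :: "(nat, nat) pre_digraph" and L where wf: "wf_digraph G"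
    and sc: "strongly_connected G" and X: "X = full_shift_topology closure_of label_sequences G L"
    using assms(1) by (auto simp: coded_system_def)
  interpret wf_digraph G by (rule wf)
  have lang: "language X = language (label_sequences G L)"
    by (simp add: X language_closure_of)
  have conn: "\<exists>es. awalk u es v" if "u \<in> verts G" "v \<in> verts G" for u v
    using sc that reachable_awalk by (auto simp: strongly_connected_def)
  have "label_sequences G L \<noteq> {}"
    using assms(2) X by (metis closure_of_empty)
  then obtain p where p: "biinfinite_path G p"
    by (auto simp: label_sequences_def)
  define e where "e = p 0"
  define v where "v = tail G e"
  have e: "e \<in> arcs G" using p by (simp add: e_def biinfinite_path_def)
  then have v: "v \<in> verts G" by (simp add: v_def)
  obtain es where "awalk (head G e) es v"
    using conn e v by force
  then have cyc: "awalk v (e # es) v"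
    using e by (simp add: awalk_Cons_iff v_def)
  define M where "M = {map L es | es. awalk v es v}"
  \<comment> \<open>Periodic repetition needs a nonempty walk, so the empty word is obtained as a
    factor of the label of the cycle.\<close>
  have nil_lang: "[] \<in> language X"
    using closed_awalk_language[OF cyc] language_sublist[of _ X "[]"] lang by auto
  have sub: "M \<subseteq> language X"
  proof
    fix w assume "w \<in> M"
    then obtain fs where "awalk v fs v" "w = map L fs" unfolding M_def by blast
    then show "w \<in> language X"
      using nil_lang lang closed_awalk_language[of v fs L] by (cases "fs = []") simp_all
  qed
  have nil: "[] \<in> M"
    using v by (auto simp: M_def awalk_Nil_iff intro!: exI[of _ "[]"])
  have app: "x @ y \<in> M" if xy: "x \<in> M" "y \<in> M" for x y
  proof -
    obtain f g where "awalk v f v" "awalk v g v" "x = map L f" "y = map L g"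
      using xy by (auto simp: M_def)
    then show ?thesis
      using awalk_appendI[of v f v g v] unfolding M_def by (metis (mono_tags, lifting) map_append mem_Collect_eq)
  qed
  have ext: "\<exists>f g. f @ w @ g \<in> M" if "w \<in> language X" for w
  proof -
    obtain x ws y where w: "awalk x ws y" "w = map L ws"
      using language_label_sequences_awalk \<open>w \<in> language X\<close> lang by metis
    then have "x \<in> verts G" "y \<in> verts G" by auto
    then obtain f g where "awalk v f x" "awalk y g v"
      using conn v by blast
    then have "awalk v (f @ ws @ g) v"
      using w(1) by (auto intro: awalk_appendI)
    then have "map L f @ w @ map L g \<in> M"
      unfolding M_def w(2) by (metis (mono_tags, lifting) map_append mem_Collect_eq)
    then show ?thesis by blast
  qed
  have "map L (e # es) \<in> M" "map L (e # es) \<noteq> []"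
    using cyc unfolding M_def by blast+
  then show ?thesis
    using that[OF sub nil app ext] by blast
qed

section \<open>Mixing and lengths modulo the cycle length\<close>

lemma ex_add_mod_eq:
  fixes m :: nat
  assumes "j < m"
  shows "\<exists>n>N. (l + n) mod m = j"
proof -
  obtain d where d: "m = Suc d"
    using assms by (cases m) auto
  \<comment> \<open>As \<open>d = m - 1\<close>, the term \<open>l * d\<close> completes
    \<open>l\<close> to a multiple of \<open>m\<close>; the last term pushes the value beyond
    \<open>N\<close>.\<close>
  let ?n = "j + l * d + m * Suc N"
  have "N < ?n"
    unfolding d by simp
  moreover have "l + ?n = j + m * (l + Suc N)"
    unfolding d by (simp add: algebra_simps)
  then have "(l + ?n) mod m = j"
    using assms by (simp only: mod_mult_self2 mod_less)
  ultimately show ?thesis by blast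
qed

text \<open>Copies of \<open>u\<close> are appended one at a time, each after a gap chosen for its
  residue. The old word stays a prefix, so earlier occurrences keep their positions.\<close>

lemma mixing_all_residues:
  assumes mix: "mixing X" and u: "u \<in> language X" and "k \<le> m"
  shows "\<exists>W\<in>language X. \<forall>j<k. \<exists>xs ys. W = xs @ u @ ys \<and> length xs mod m = j"
  using \<open>k \<le> m\<close>
proof (induction k)
  case 0
  then show ?case using u by blast
next
  case (Suc k)
  then obtain W where W: "W \<in> language X"
    "\<And>j. j < k \<Longrightarrow> \<exists>xs ys. W = xs @ u @ ys \<and> length xs mod m = j"
    by auto
  obtain N where N: "\<And>n. n > N \<Longrightarrow> \<exists>w\<in>language_n n X. W @ w @ u \<in> language X"
    using mix W(1) u unfolding mixing_def by blast
  \<comment> \<open>Mixing controls only gaps longer than \<open>N\<close>, but every residue class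
    contains such gaps.\<close>
  obtain n where n: "n > N" "(length W + n) mod m = k"
    using ex_add_mod_eq[of k m] Suc.prems by (metis Suc_le_eq)
  obtain w where w: "length w = n" "W @ w @ u \<in> language X"
    using N[OF n(1)] by (auto simp: language_n_def)
  have "\<exists>xs ys. W @ w @ u = xs @ u @ ys \<and> length xs mod m = j" if "j < Suc k" for j
  proof (cases "j = k")
    case True
    then have "W @ w @ u = (W @ w) @ u @ [] \<and> length (W @ w) mod m = j"
      using w(1) n(2) by simp
    then show ?thesis by blast
  next
    case False
    then obtain xs ys where "W = xs @ u @ ys" "length xs mod m = j"
      using W(2)[of j] \<open>j < Suc k\<close> by auto
    then have "W @ w @ u = xs @ u @ (ys @ w @ u) \<and> length xs mod m = j" by simp
    then show ?thesis by blast
  qed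
  then show ?case using w(2) by blast
qed

lemma concat_map_mem_monoid:
  assumes "[] \<in> M" "\<And>x y. x \<in> M \<Longrightarrow> y \<in> M \<Longrightarrow> x @ y \<in> M" "\<And>i. i \<in> set is \<Longrightarrow> f i \<in> M"
  shows "concat (map f is) \<in> M"
  using assms(3) by (induction "is") (auto intro: assms(1,2))

text \<open>The prefix \<open>f\<close> that completes \<open>W\<close> has unknown length and is
  found only after \<open>W\<close>. Hence \<open>W\<close> carries \<open>u\<close> at every
  residue, and the copy that cancels the residue of \<open>f\<close> is used.\<close>

lemma mixing_divisible_extension:
  assumes mix: "mixing X" and u: "u \<in> language X" and m: "0 < m"
    and nil: "[] \<in> M" and app: "\<And>x y. x \<in> M \<Longrightarrow> y \<in> M \<Longrightarrow> x @ y \<in> M"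
    and ext: "\<And>w. w \<in> language X \<Longrightarrow> \<exists>f g. f @ w @ g \<in> M"
  obtains a b where "a @ u @ b \<in> M" "m dvd length a" "m dvd length (a @ u @ b)"
proof -
  obtain W where W: "W \<in> language X"
    "\<And>j. j < m \<Longrightarrow> \<exists>xs ys. W = xs @ u @ ys \<and> length xs mod m = j"
    using mixing_all_residues[OF mix u order_refl] by blast
  obtain f g where fg: "f @ W @ g \<in> M"
    using ext[OF W(1)] by blast
  obtain n where n: "(length f + n) mod m = 0"
    using ex_add_mod_eq[OF m, of 0 "length f"] by metis
  obtain xs ys where xy: "W = xs @ u @ ys" "length xs mod m = n mod m"
    using W(2)[of "n mod m"] m by auto
  define a where "a = f @ xs"
  define b where "b = ys @ g"
  have aub: "a @ u @ b \<in> M"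
    using fg xy(1) by (simp add: a_def b_def)
  have a: "m dvd length a"
    using n xy(2) by (simp add: a_def dvd_eq_mod_eq_0) (metis mod_add_right_eq)
  \<comment> \<open>Further copies of the whole block go into the suffix only: the total length is
    multiplied by \<open>m\<close>, while \<open>a\<close> is untouched.\<close>
  let ?b = "b @ concat (map (\<lambda>_. a @ u @ b) [0..<m - 1])"
  have "concat (map (\<lambda>_. a @ u @ b) [0..<m - 1]) \<in> M"
    by (rule concat_map_mem_monoid) (use nil app aub in auto)
  then have "a @ u @ ?b \<in> M"
    using app[OF aub] by simp
  moreover have "length (a @ u @ ?b) = m * length (a @ u @ b)"
    using m by (cases m) (simp_all add: length_concat o_def sum_list_triv algebra_simps)
  then have "m dvd length (a @ u @ ?b)" by simp
  ultimately show ?thesis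
    using a that by blast
qed

text \<open>The total length \<open>2 r m\<close> leaves room to pad on both sides once \<open>r\<close> is large.\<close>

lemma mixing_uniform_extension:
  assumes mix: "mixing X" and u: "u \<in> language X"
    and nil: "[] \<in> M" and app: "\<And>x y. x \<in> M \<Longrightarrow> y \<in> M \<Longrightarrow> x @ y \<in> M"
    and ext: "\<And>w. w \<in> language X \<Longrightarrow> \<exists>f g. f @ w @ g \<in> M"
    and c: "c \<in> M" "c \<noteq> []"
  shows "\<exists>R. \<forall>r\<ge>R. \<exists>a b. a @ u @ b \<in> M \<and> length a = r * length c \<and>
    length (a @ u @ b) = 2 * r * length c"
proof -
  let ?m = "length c"
  obtain a b where aub: "a @ u @ b \<in> M" and "?m dvd length a" "?m dvd length (a @ u @ b)"
    using mixing_divisible_extension[OF mix u _ nil app ext, of ?m] c(2) by blast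
  then obtain q t where q: "length a = q * ?m" and t: "length (a @ u @ b) = t * ?m"
    by (metis dvd_def mult.commute)
  define pad where "pad s = concat (map (\<lambda>_. c) [0..<s])" for s :: nat
  have pad: "pad s \<in> M" for s
    unfolding pad_def by (rule concat_map_mem_monoid) (use nil app c in auto)
  have len_pad: "length (pad s) = s * ?m" for s
    by (simp add: pad_def length_concat o_def sum_list_triv)
  have "\<exists>a b. a @ u @ b \<in> M \<and> length a = r * ?m \<and> length (a @ u @ b) = 2 * r * ?m"
    if r: "r \<ge> q + t" for r
  proof (intro exI conjI)
    \<comment> \<open>The bound on \<open>r\<close> makes both subtractions exact. In units of
      \<open>length c\<close>, the left padding brings the prefix to \<open>r\<close>, and the right
      one brings the total to \<open>2 * r\<close>.\<close>
    let ?a = "pad (r - q) @ a" and ?b = "b @ pad (r - t + q)"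
    show "?a @ u @ ?b \<in> M"
      using app[OF pad app[OF aub pad]] by simp
    have "length ?a = (r - q + q) * ?m"
      using q len_pad by (simp add: algebra_simps)
    then show "length ?a = r * ?m" using r by simp
    have "length (?a @ u @ ?b) = (r - q + t + (r - t + q)) * ?m"
      using t len_pad by (simp add: algebra_simps)
    moreover have "r - q + t + (r - t + q) = 2 * r" using r by simp
    ultimately show "length (?a @ u @ ?b) = 2 * r * ?m" by simp
  qed
  then show ?thesis by blast
qed

section \<open>Assembling blocks into the strong property P\<close>

lemma concat_regroup:
  assumes "1 \<le> N"
  shows "a 1 @ concat (map (\<lambda>i. u i @ b i @ a (Suc i)) [1..<N]) @ u N @ b N =
    concat (map (\<lambda>i. a i @ u i @ b i) [1..<Suc N])"
  using assms
proof (induction N rule: dec_induct)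
  case (step n)
  then have "concat (map (\<lambda>i. a i @ u i @ b i) [1..<Suc (Suc n)]) =
      (a 1 @ concat (map (\<lambda>i. u i @ b i @ a (Suc i)) [1..<n]) @ u n @ b n) @
      a (Suc n) @ u (Suc n) @ b (Suc n)"
    by simp
  then show ?case
    using step(1) by simp
qed simp

theorem theorem6p2:
  fixes X :: "(int \<Rightarrow> 'a::finite) set"
  assumes "CARD('a) \<ge> 2"
    and "coded_system X"
    and "mixing X"
  shows "strong_property_P X"
  unfolding strong_property_P_def
proof (intro allI impI, elim conjE)
  fix k :: nat and u :: "nat \<Rightarrow> 'a list"
  assume k: "2 \<le> k" and u: "\<forall>i\<in>{1..k}. u i \<in> language X"
    and len: "\<forall>i\<in>{1..k}. \<forall>j\<in>{1..k}. length (u i) = length (u j)"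
  have "u 1 \<in> language X" using u k by simp
  then have "X \<noteq> {}" by (auto simp: language_def)
  then obtain M c where sub: "M \<subseteq> language X" and nil: "[] \<in> M"
    and app: "\<And>x y. x \<in> M \<Longrightarrow> y \<in> M \<Longrightarrow> x @ y \<in> M"
    and ext: "\<And>w. w \<in> language X \<Longrightarrow> \<exists>f g. f @ w @ g \<in> M" and c: "c \<in> M" "c \<noteq> []"
    using coded_system_word_monoid[OF assms(2)] by metis
  let ?m = "length c"
  have "\<forall>i\<in>{1..k}. \<exists>R. \<forall>r\<ge>R. \<exists>a b. a @ u i @ b \<in> M \<and> length a = r * ?m \<and>
      length (a @ u i @ b) = 2 * r * ?m"
    using mixing_uniform_extension[OF assms(3) _ nil app ext c] u by blast
  then obtain R where R: "\<And>i r. i \<in> {1..k} \<Longrightarrow> r \<ge> R i \<Longrightarrow>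
      \<exists>a b. a @ u i @ b \<in> M \<and> length a = r * ?m \<and> length (a @ u i @ b) = 2 * r * ?m"
    by (metis (no_types, lifting))
  \<comment> \<open>A sum of naturals dominates each summand, so one \<open>r\<close> serves all
    words; \<open>Suc\<close> makes it positive, which yields \<open>1 \<le> n\<close>.\<close>
  define r where "r = Suc (sum R {1..k})"
  have "R i \<le> r" if "i \<in> {1..k}" for i
    using member_le_sum[OF that, of R] by (simp add: r_def)
  then have "\<forall>i\<in>{1..k}. \<exists>a b. a @ u i @ b \<in> M \<and> length a = r * ?m \<and>
      length (a @ u i @ b) = 2 * r * ?m"
    using R by blast
  then obtain a b where ab: "\<And>i. i \<in> {1..k} \<Longrightarrow> a i @ u i @ b i \<in> M"
    "\<And>i. i \<in> {1..k} \<Longrightarrow> length (a i) = r * ?m"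
    "\<And>i. i \<in> {1..k} \<Longrightarrow> length (a i @ u i @ b i) = 2 * r * ?m"
    by metis
  \<comment> \<open>A gap is the suffix of one block followed by the prefix of the next. Its length
    is constant because \<open>a i\<close>, \<open>u i\<close> and the whole block have lengths
    independent of \<open>i\<close>.\<close>
  define n where "n = length (b 1) + r * ?m"
  have "length (b i) = length (b 1)" if "i \<in> {1..k}" for i
  proof -
    have "1 \<in> {1..k}" using k by simp
    then show ?thesis
      using ab(2,3)[OF that] ab(2,3)[of 1] len that by fastforce
  qed
  then have n: "length (b i @ a j) = n" if "i \<in> {1..k}" "j \<in> {1..k}" for i j
    unfolding n_def length_append by (metis ab(2) that)
  show "\<exists>n\<ge>1. \<forall>N\<ge>1. \<forall>\<phi>\<in>{1..N} \<rightarrow> {1..k}. \<exists>w. (\<forall>i\<in>{1..<N}. w i \<in> language_n n X) \<and>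
      concat (map (\<lambda>i. u (\<phi> i) @ w i) [1..<N]) @ u (\<phi> N) \<in> language X"
  proof (intro exI[of _ n] conjI allI impI ballI)
    show "1 \<le> n" using c(2) by (simp add: n_def r_def Suc_le_eq)
    fix N :: nat and \<phi> assume N: "1 \<le> N" and \<phi>: "\<phi> \<in> {1..N} \<rightarrow> {1..k}"
    let ?w = "\<lambda>i. b (\<phi> i) @ a (\<phi> (Suc i))"
    have "?w i \<in> language_n n X" if "i \<in> {1..<N}" for i
    proof -
      have i: "\<phi> i \<in> {1..k}" "\<phi> (Suc i) \<in> {1..k}"
        using \<phi> that by (auto simp: Pi_iff)
      \<comment> \<open>The gap is a word of \<open>X\<close> as a factor of the product of two
        adjacent blocks.\<close>
      let ?p = "a (\<phi> i) @ u (\<phi> i)" and ?s = "u (\<phi> (Suc i)) @ b (\<phi> (Suc i))"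
      have "?p @ ?w i @ ?s \<in> language X"
        using app[OF ab(1)[OF i(1)] ab(1)[OF i(2)]] sub by auto
      then have "?w i \<in> language X"
        by (rule language_sublist) (rule sublist_appendI)
      then show ?thesis using n[OF i] by (simp add: language_n_def)
    qed
    moreover have "concat (map (\<lambda>i. u (\<phi> i) @ ?w i) [1..<N]) @ u (\<phi> N) \<in> language X"
    proof -
      have "concat (map (\<lambda>i. a (\<phi> i) @ u (\<phi> i) @ b (\<phi> i)) [1..<Suc N]) \<in> M"
        by (rule concat_map_mem_monoid[OF nil app]) (use \<phi> ab(1) in \<open>auto simp: Pi_iff\<close>)
      \<comment> \<open>Regrouping each inner suffix with the following prefix leaves only the first
        prefix and the last suffix outside the required word, which is therefore a factor of an
        element of \<open>M\<close>.\<close>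
      then have "a (\<phi> 1) @ (concat (map (\<lambda>i. u (\<phi> i) @ ?w i) [1..<N]) @ u (\<phi> N)) @ b (\<phi> N)
          \<in> language X"
        using concat_regroup[OF N, of "a \<circ> \<phi>" "u \<circ> \<phi>" "b \<circ> \<phi>"] sub by auto
      then show ?thesis
        by (rule language_sublist) (rule sublist_appendI)
    qed
    ultimately show "\<exists>w. (\<forall>i\<in>{1..<N}. w i \<in> language_n n X) \<and>
        concat (map (\<lambda>i. u (\<phi> i) @ w i) [1..<N]) @ u (\<phi> N) \<in> language X"
      by (intro exI[of _ ?w] conjI ballI)
  qed
qed

end
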